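(* Let $G$ be a graph of girth $g\ge6$ such that the distance satisfies $d(u,v)\ge6$ for every two distinct vertices $u,v\in K(G)$, where $K(G)=\{v\in V(G):\deg(v)\ge3\}$. Then $\chi_{\rm pcf}(G)\le4$.
   Context: All graphs are simple, finite and undirected. A vertex coloring of a graph is proper if adjacent vertices get distinct colors. It is conflict-free (with respect to open neighborhoods) if for every non-isolated vertex $x$ there is a color that appears exactly once on the open neighborhood $N(x)$. A PCF $k$-coloring is a vertex coloring with at most $k$ colors that is both proper and conflict-free. The PCF chromatic number $\chi_{\rm pcf}(G)$ is the minimum $k$ for which $G$ admits a PCF $k$-coloring. The girth of $G$ is the length of a shortest cycle in $G$ (infinite if $G$ has no cycle); $d(u,v)$ is the usual graph distance (infinite for vertices in different components). *)

theory Defs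
  imports "Graph_Theory.Graph_Theory" "HOL-Library.Extended_Nat"
begin

text \<open>
  A finite simple undirected graph is a \<^locale>\<open>pair_graph\<close>: a finite vertex set together with
  a symmetric irreflexive relation. An undirected edge is represented by its two
  opposite arcs, so the degree of a vertex is its \<^const>\<open>out_degree\<close>.
\<close>

definition neighborhood :: "'a pair_pre_digraph \<Rightarrow> 'a \<Rightarrow> 'a set" where
  "neighborhood G v = {w. (v, w) \<in> parcs G}"

text \<open>
  In a symmetric digraph the library's \<^const>\<open>pre_digraph.cycle\<close> also admits the closed walk
  of length two along an edge and back. The bound on the length removes these; what is
  left are exactly the cycles of the undirected graph. The infimum over the empty set is infinity.
\<close>
definition girth :: "'a pair_pre_digraph \<Rightarrow> enat" where
  "girth G = (INF p \<in> {p. pre_digraph.cycle (with_proj G) p \<and> 3 \<le> length p}. enat (length p))"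

definition graph_dist :: "'a pair_pre_digraph \<Rightarrow> 'a \<Rightarrow> 'a \<Rightarrow> ereal" where
  "graph_dist G = wf_digraph.\<mu> (with_proj G) (\<lambda>_. 1)"

definition K :: "'a pair_pre_digraph \<Rightarrow> 'a set" where
  "K G = {v \<in> pverts G. out_degree (with_proj G) v \<ge> 3}"

definition proper_coloring :: "'a pair_pre_digraph \<Rightarrow> ('a \<Rightarrow> 'c) \<Rightarrow> bool" where
  "proper_coloring G c \<longleftrightarrow> (\<forall>u v. (u, v) \<in> parcs G \<longrightarrow> c u \<noteq> c v)"

definition conflict_free :: "'a pair_pre_digraph \<Rightarrow> ('a \<Rightarrow> 'c) \<Rightarrow> bool" where
  "conflict_free G c \<longleftrightarrow>
     (\<forall>x \<in> pverts G. neighborhood G x \<noteq> {} \<longrightarrow>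
        (\<exists>a. card {y \<in> neighborhood G x. c y = a} = 1))"

definition pcf_coloring :: "'a pair_pre_digraph \<Rightarrow> nat \<Rightarrow> ('a \<Rightarrow> 'c) \<Rightarrow> bool" where
  "pcf_coloring G k c \<longleftrightarrow>
     proper_coloring G c \<and> conflict_free G c \<and> card (c ` pverts G) \<le> k"

text \<open>
  Natural numbers serve as colors; a finite graph needs only finitely many.
  The minimum is attained, see \<open>pcf_chromatic_number_attained\<close> below.
\<close>
definition pcf_chromatic_number :: "'a pair_pre_digraph \<Rightarrow> nat" where
  "pcf_chromatic_number G = (LEAST k. \<exists>c :: 'a \<Rightarrow> nat. pcf_coloring G k c)"

lemma pcf_chromatic_number_attained:
  assumes "pair_graph G"
  shows "\<exists>c :: 'a \<Rightarrow> nat. pcf_coloring (G :: 'a pair_pre_digraph) (pcf_chromatic_number G) c"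
proof -
  have fin: "finite (pverts G)"
    using assms by (simp add: pair_graph_def pair_digraph_def pair_fin_digraph_def pair_fin_digraph_axioms_def)
  have arcs: "u \<in> pverts G" "v \<in> pverts G" "u \<noteq> v" if "(u, v) \<in> parcs G" for u v
    using assms that
    unfolding pair_graph_def pair_digraph_def pair_loopfree_digraph_def
      pair_loopfree_digraph_axioms_def pair_wf_digraph_def by force+
  obtain c :: "'a \<Rightarrow> nat" where c: "inj_on c (pverts G)"
    using finite_imp_inj_to_nat_seg[OF fin] by blast
  have "proper_coloring G c"
    unfolding proper_coloring_def using inj_onD[OF c] arcs by blast
  moreover have "conflict_free G c"
    unfolding conflict_free_def
  proof (intro ballI impI)
    fix x assume "neighborhood G x \<noteq> {}"
    then obtain y where y: "y \<in> neighborhood G x" by blast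
    have sub: "neighborhood G x \<subseteq> pverts G"
      unfolding neighborhood_def using arcs(2) by blast
    have "z = y" if "z \<in> neighborhood G x" "c z = c y" for z
      using inj_onD[OF c that(2)] subsetD[OF sub] that(1) y by blast
    then have "{z \<in> neighborhood G x. c z = c y} = {y}"
      using y by blast
    then have "card {z \<in> neighborhood G x. c z = c y} = 1" by simp
    then show "\<exists>a. card {z \<in> neighborhood G x. c z = a} = 1" ..
  qed
  ultimately have "pcf_coloring G (card (c ` pverts G)) c"
    by (simp add: pcf_coloring_def)
  then have "\<exists>k. \<exists>c :: 'a \<Rightarrow> nat. pcf_coloring G k c"
    by blast
  then show ?thesis
    unfolding pcf_chromatic_number_def by (rule LeastI_ex)
qed

end

theory Submission
  imports Defs
begin

text \<open>
  Give every vertex of \<open>K\<close> the color 0, one neighbor of each vertex of \<open>K\<close> the color 1, and its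
  other neighbors the color 2. The remaining graph has maximum degree 2, so it splits into
  paths and cycles, where it suffices to make any three consecutive vertices distinct. A thread
  between two vertices of \<open>K\<close> has at least five inner vertices and a cycle at least six, which
  leaves enough room: a word in which three consecutive letters are distinct can be lengthened by
  repeating its first three letters, so only three lengths have to be checked by hand.
\<close>

section \<open>Color words whose windows of length three are rainbow\<close>

text \<open>The number \<open>n\<close> counts windows, so only slots 0 to \<open>n + 1\<close>
  matter. Slots 1 to \<open>n\<close> are meant for the vertices of a path and the two outer slots
  for a further neighbor of either end. The window starting at \<open>i\<close> then covers the
  closed neighborhood of the vertex in slot \<open>i + 1\<close>.\<close>

definition rainbow :: "nat \<Rightarrow> (nat \<Rightarrow> nat) \<Rightarrow> bool" where
  "rainbow n g \<longleftrightarrow> (\<forall>i<n. distinct [g i, g (i + 1), g (i + 2)]) \<and> (\<forall>i<n + 2. g i < 4)"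

text \<open>Repeating the first three letters in front creates only windows that are cyclic shifts
  of these letters, which are distinct because \<open>n \<ge> 1\<close>. The two letters at either
  end survive, and with them every boundary condition used below.\<close>

lemma rainbow_lengthen:
  assumes "rainbow n g" "n \<ge> 1"
  shows "\<exists>h. rainbow (n + 3) h \<and> h 0 = g 0 \<and> h 1 = g 1 \<and> h (n + 3) = g n \<and> h (n + 3 + 1) = g (n + 1)"
proof -
  define h where "h i = (if i < 3 then g i else g (i - 3))" for i
  have "distinct [g 0, g (0 + 1), g (0 + 2)]"
    using assms unfolding rainbow_def by fastforce
  then have d: "distinct [g 0, g 1, g 2]"
    by (simp add: numeral_2_eq_2)
  have "distinct [h i, h (i + 1), h (i + 2)]" if "i < n + 3" for i
  proof -
    have "i < 3 \<or> i - 3 < n \<and> i = i - 3 + 3"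
      using that by linarith
    then consider "i = 0" | "i = 1" | "i = 2" | j where "i = j + 3" "j < n"
      by (auto simp: less_Suc_eq numeral_eq_Suc)
    then show ?thesis
    proof cases
      case 4
      then show ?thesis using assms(1) by (simp add: h_def rainbow_def)
    qed (use d in \<open>auto simp: h_def numeral_eq_Suc\<close>)
  qed
  moreover have "h i < 4" if "i < n + 3 + 2" for i
    using assms that unfolding rainbow_def h_def by auto
  ultimately have "rainbow (n + 3) h"
    by (simp add: rainbow_def)
  then show ?thesis
    by (intro exI[of _ h]) (simp add: h_def)
qed

text \<open>Length 5 is the threshold: for \<open>n = 4\<close> and \<open>a \<noteq> b\<close>,
  slot 2 would have to be 3, and slot 3 would then see all four colors in slots 1, 2, 4 and
  5.\<close>

lemma rainbow_between:
  assumes "5 \<le> n" and ab: "a \<in> {1, 2}" "b \<in> {1, 2}"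
  shows "\<exists>g. rainbow n g \<and> g 0 = 0 \<and> g 1 = a \<and> g n = b \<and> g (n + 1) = 0"
  using assms(1)
proof (induction n rule: less_induct)
  case (less n)
  consider "n = 5" | "n = 6" | "n = 7" | "n \<ge> 8"
    using less.prems by linarith
  then show ?case
  proof cases
    \<comment> \<open>As \<open>a\<close> is 1 or 2, \<open>3 - a\<close> is the other of these two
      colors; it equals \<open>b\<close> when \<open>a \<noteq> b\<close>.\<close>
    case 1
    show ?thesis
      by (rule exI[of _ "nth (if a = b then [0, a, 3 - a, 0, 3, a, 0] else [0, a, 3, 0, a, b, 0])"])
        (use ab in \<open>auto simp: 1 rainbow_def numeral_eq_Suc All_less_Suc\<close>)
  next
    case 2
    show ?thesis
      by (rule exI[of _ "nth (if a = b then [0, a, 3 - a, 0, 3, 3 - a, a, 0]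
            else [0, a, 3, 0, a, 3, b, 0])"])
        (use ab in \<open>auto simp: 2 rainbow_def numeral_eq_Suc All_less_Suc\<close>)
  next
    case 3
    show ?thesis
      by (rule exI[of _ "nth (if a = b then [0, a, 3 - a, 3, 0, 3 - a, 3, a, 0]
            else [0, a, 3 - a, 3, 0, a, 3, b, 0])"])
        (use ab in \<open>auto simp: 3 rainbow_def numeral_eq_Suc All_less_Suc\<close>)
  next
    case 4
    define m where "m = n - 3"
    have m: "n = m + 3" "m < n" "5 \<le> m"
      using 4 by (auto simp: m_def)
    then obtain g where g: "rainbow m g" "g 0 = 0" "g 1 = a" "g m = b" "g (m + 1) = 0"
      using less.IH[OF m(2,3)] by blast
    obtain h where "rainbow (m + 3) h" "h 0 = g 0" "h 1 = g 1" "h (m + 3) = g m"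
      "h (m + 3 + 1) = g (m + 1)"
      using rainbow_lengthen[OF g(1)] m(3) by auto
    then show ?thesis
      unfolding m(1) using g by metis
  qed
qed

text \<open>The two equations let the word close up around a cycle. The base words consist of blocks
  012 and 0123, followed by their first two letters again. Length 5 is impossible: any two vertices
  of a 5-cycle share a window, which would require five colors.\<close>

lemma rainbow_cyclic:
  assumes "6 \<le> n"
  shows "\<exists>g. rainbow n g \<and> g 0 = g n \<and> g (n + 1) = g 1"
  using assms
proof (induction n rule: less_induct)
  case (less n)
  consider "n = 6" | "n = 7" | "n = 8" | "n \<ge> 9"
    using less.prems by linarith
  then show ?case
  proof cases
    case 1
    show ?thesis
      by (rule exI[of _ "nth [0, 1, 2, 0, 1, 2, 0, 1]"])
        (simp add: 1 rainbow_def numeral_eq_Suc All_less_Suc)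
  next
    case 2
    show ?thesis
      by (rule exI[of _ "nth [0, 1, 2, 3, 0, 1, 2, 0, 1]"])
        (simp add: 2 rainbow_def numeral_eq_Suc All_less_Suc)
  next
    case 3
    show ?thesis
      by (rule exI[of _ "nth [0, 1, 2, 3, 0, 1, 2, 3, 0, 1]"])
        (simp add: 3 rainbow_def numeral_eq_Suc All_less_Suc)
  next
    case 4
    define m where "m = n - 3"
    have m: "n = m + 3" "m < n" "6 \<le> m"
      using 4 by (auto simp: m_def)
    then obtain g where g: "rainbow m g" "g 0 = g m" "g (m + 1) = g 1"
      using less.IH[OF m(2,3)] by blast
    obtain h where "rainbow (m + 3) h" "h 0 = g 0" "h 1 = g 1" "h (m + 3) = g m"
      "h (m + 3 + 1) = g (m + 1)"
      using rainbow_lengthen[OF g(1)] m(3) by auto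
    then show ?thesis
      unfolding m(1) using g by metis
  qed
qed

text \<open>With only one end constrained, repeating the letters 0, \<open>a\<close>, 3 works for
  every length.\<close>

lemma rainbow_from:
  assumes "a \<in> {1, 2}"
  shows "\<exists>g. rainbow n g \<and> g 0 = 0 \<and> g 1 = a"
proof -
  define g where "g i = (if i mod 3 = 0 then 0 else if i mod 3 = 1 then a else 3)" for i :: nat
  have "distinct [g i, g (i + 1), g (i + 2)]" for i
  proof -
    have "i mod 3 = 0 \<and> (i + 1) mod 3 = 1 \<and> (i + 2) mod 3 = 2 \<or>
      i mod 3 = 1 \<and> (i + 1) mod 3 = 2 \<and> (i + 2) mod 3 = 0 \<or>
      i mod 3 = 2 \<and> (i + 1) mod 3 = 0 \<and> (i + 2) mod 3 = 1"
      by presburger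
    then show ?thesis
      using assms by (elim disjE conjE) (auto simp: g_def)
  qed
  moreover have "g i < 4" for i
    using assms by (auto simp: g_def)
  ultimately have "rainbow n g"
    by (simp add: rainbow_def)
  moreover have "g 0 = 0" "g 1 = a"
    by (simp_all add: g_def)
  ultimately show ?thesis
    by blast
qed

lemma rainbow_rev:
  assumes "rainbow n g"
  shows "rainbow n (\<lambda>i. g (n + 1 - i))"
  unfolding rainbow_def
proof (intro conjI allI impI)
  fix i assume "i < n"
  then have "distinct [g (n - 1 - i), g (n - 1 - i + 1), g (n - 1 - i + 2)]"
    using assms by (simp add: rainbow_def)
  moreover have "n - 1 - i + 1 = n - i" "n - 1 - i + 2 = n + 1 - i"
    using \<open>i < n\<close> by auto
  ultimately show "distinct [g (n + 1 - i), g (n + 1 - (i + 1)), g (n + 1 - (i + 2))]"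
    by auto
next
  fix i assume "i < n + 2"
  then show "g (n + 1 - i) < 4"
    using assms by (simp add: rainbow_def)
qed

section \<open>Coloring the vertices outside \<open>K\<close> along paths and cycles\<close>

text \<open>Distance and girth enter only as length bounds on paths avoiding \<open>K\<close>. The
  color that \<open>u\<close> in \<open>K\<close> prescribes for its neighbor \<open>w\<close> is
  \<open>f u w\<close>. In \<open>thread\<close>, the case of a single vertex with
  \<open>u = v\<close> is left out, since going from \<open>u\<close> to it and back is no
  cycle.\<close>

locale far_branching =
  fixes E :: "'a rel" and K :: "'a set" and f :: "'a \<Rightarrow> 'a \<Rightarrow> nat"
  fixes path :: "'a list \<Rightarrow> bool"
  defines "path xs \<equiv> xs \<noteq> [] \<and> distinct xs \<and> set xs \<inter> K = {} \<and> successively (\<lambda>x y. (x, y) \<in> E) xs"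
  assumes symE: "(x, y) \<in> E \<Longrightarrow> (y, x) \<in> E"
    and irrefl: "(x, x) \<notin> E"
    and degree: "w \<notin> K \<Longrightarrow> (w, x) \<in> E \<Longrightarrow> (w, y) \<in> E \<Longrightarrow> (w, z) \<in> E \<Longrightarrow> x = y \<or> y = z \<or> x = z"
    and thread: "path xs \<Longrightarrow> u \<in> K \<Longrightarrow> v \<in> K \<Longrightarrow> (u, hd xs) \<in> E \<Longrightarrow> (last xs, v) \<in> E \<Longrightarrow>
      u \<noteq> v \<or> 2 \<le> length xs \<Longrightarrow> 5 \<le> length xs"
    and cycle: "path xs \<Longrightarrow> 3 \<le> length xs \<Longrightarrow> (last xs, hd xs) \<in> E \<Longrightarrow> 6 \<le> length xs"
    and f: "f u w \<in> {1, 2}"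
begin

lemma path_nth_Suc:
  assumes "path xs" "i + 1 < length xs"
  shows "(xs ! i, xs ! (i + 1)) \<in> E"
  using assms unfolding path_def successively_conv_nth by simp

lemma path_nth_notin:
  assumes "path xs" "i < length xs"
  shows "xs ! i \<notin> K"
  using assms nth_mem unfolding path_def by blast

text \<open>The two list neighbors are distinct and already use up the degree bound.\<close>

lemma inner_neighbor:
  assumes "path xs" "0 < i" "i + 1 < length xs" "(xs ! i, y) \<in> E"
  shows "y = xs ! (i - 1) \<or> y = xs ! (i + 1)"
proof -
  have "(xs ! i, xs ! (i - 1)) \<in> E" "(xs ! i, xs ! (i + 1)) \<in> E"
    using path_nth_Suc[OF assms(1), of i] path_nth_Suc[OF assms(1), of "i - 1"] symE assms by auto
  moreover have "xs ! (i - 1) \<noteq> xs ! (i + 1)"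
    using assms unfolding path_def by (simp add: nth_eq_iff_index_eq)
  moreover have "xs ! i \<notin> K"
    using path_nth_notin assms by simp
  ultimately show ?thesis
    using degree assms(4) by blast
qed

text \<open>A new neighbor of an end would extend the path, and an inner vertex has no neighbor
  besides its two on the path. Comparing only with lists inside \<open>insert y (set xs)\<close>
  allows the path to be longest merely within a given vertex set.\<close>

lemma maximal_path_closed:
  assumes "path xs" "x \<in> set xs" "(x, y) \<in> E"
    and max: "\<And>ys. path ys \<Longrightarrow> set ys \<subseteq> insert y (set xs) \<Longrightarrow> length ys \<le> length xs"
  shows "y \<in> set xs \<union> K"
proof (rule ccontr)
  assume y: "y \<notin> set xs \<union> K"
  obtain i where i: "i < length xs" "x = xs ! i"
    using assms(2) by (metis in_set_conv_nth)
  consider "i = 0" | "i = length xs - 1" | "0 < i" "i + 1 < length xs"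
    using i(1) by linarith
  then show False
  proof cases
    case 1
    then have "path (y # xs)"
      using assms(1,3) y i(2) symE unfolding path_def by (cases xs) auto
    then show False using max[of "y # xs"] by auto
  next
    case 2
    then have "path (xs @ [y])"
      using assms(1,3) y i(2) unfolding path_def
      by (auto simp: successively_append_iff last_conv_nth)
    then show False using max[of "xs @ [y]"] by auto
  next
    case 3
    then show False
      using inner_neighbor[OF assms(1), of i y] assms(3) i y by auto
  qed
qed

text \<open>Distinct colors on the closed neighborhood settle properness and conflict-freeness at
  \<open>w\<close> together. Vertices of \<open>K\<close> may have too many neighbors for this; the
  last clause hands them control over the colors around them instead.\<close>

definition good_at :: "('a \<Rightarrow> nat) \<Rightarrow> 'a \<Rightarrow> bool" where
  "good_at c w \<longleftrightarrow> c w < 4 \<and> inj_on c (insert w (E `` {w})) \<and> (\<forall>u\<in>K. (w, u) \<in> E \<longrightarrow> c w = f u w)"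

text \<open>A one-vertex path between two different vertices of \<open>K\<close> would violate
  \<open>thread\<close>. Hence \<open>w\<close> has at most one neighbor and can take the color
  prescribed by it.\<close>

lemma color_singleton:
  assumes "w \<notin> K" "E `` {w} \<subseteq> insert w K"
  shows "\<exists>c. (\<forall>x\<in>K. c x = 0) \<and> good_at c w"
proof -
  have nb: "E `` {w} \<subseteq> K"
    using assms(2) irrefl by auto
  have one: "u = v" if "(w, u) \<in> E" "(w, v) \<in> E" for u v
    using thread[of "[w]" u v] that assms(1) nb symE unfolding path_def by auto
  \<comment> \<open>If \<open>w\<close> has no neighbor, the choice is arbitrary but harmless, as
    \<open>f\<close> only takes the values 1 and 2.\<close>
  define c where "c x = (if x = w then f (SOME u. (w, u) \<in> E) w else 0)" for x
  have "good_at c w"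
    unfolding good_at_def
  proof (intro conjI ballI impI)
    show "c w < 4"
      using f[of "SOME u. (w, u) \<in> E" w] by (auto simp: c_def)
    have "c w \<noteq> 0"
      using f[of "SOME u. (w, u) \<in> E" w] by (auto simp: c_def)
    then show "inj_on c (insert w (E `` {w}))"
      using one unfolding inj_on_def c_def by auto
    show "c w = f u w" if "(w, u) \<in> E" for u
      using one[OF that] that by (metis c_def someI)
  qed
  then show ?thesis
    using assms(1) by (intro exI[of _ c]) (auto simp: c_def)
qed

text \<open>The cases are a path closing up to a cycle, or one with a neighbor in \<open>K\<close>
  at both, one or neither of its ends. By the degree bound each end has at most one neighbor in
  \<open>K\<close>. The condition \<open>3 \<le> n\<close> keeps the edge of a two-vertex path from
  counting as a cycle.\<close>

lemma boundary_word:
  assumes "path xs" "2 \<le> length xs"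
  defines "n \<equiv> length xs"
  shows "\<exists>g. rainbow n g \<and> (\<forall>u\<in>K. (u, hd xs) \<in> E \<longrightarrow> g 0 = 0 \<and> g 1 = f u (hd xs)) \<and>
    (\<forall>v\<in>K. (last xs, v) \<in> E \<longrightarrow> g (n + 1) = 0 \<and> g n = f v (last xs)) \<and>
    (3 \<le> n \<and> (last xs, hd xs) \<in> E \<longrightarrow> g 0 = g n \<and> g (n + 1) = g 1)"
proof -
  have ne: "xs \<noteq> []" "hd xs \<noteq> last xs" "hd xs \<notin> K" "last xs \<notin> K"
    using assms(1,2) unfolding path_def
    by (auto simp: hd_conv_nth last_conv_nth nth_eq_iff_index_eq disjoint_iff)
  have hd1: "(hd xs, xs ! 1) \<in> E" "xs ! 1 \<notin> K"
    using path_nth_Suc[OF assms(1), of 0] assms(1,2) ne unfolding path_def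
    by (auto simp: hd_conv_nth disjoint_iff)
  have last1: "(last xs, xs ! (n - 2)) \<in> E" "xs ! (n - 2) \<notin> K"
    using path_nth_Suc[OF assms(1), of "n - 2"] symE assms(1,2) ne unfolding path_def
    by (auto simp: last_conv_nth disjoint_iff n_def Suc_diff_Suc numeral_2_eq_2)
  have left: "u = v" if "u \<in> K" "v \<in> K" "(u, hd xs) \<in> E" "(v, hd xs) \<in> E" for u v
    using degree[OF ne(3) hd1(1), of u v] that symE hd1(2) by blast
  have right: "u = v" if "u \<in> K" "v \<in> K" "(last xs, u) \<in> E" "(last xs, v) \<in> E" for u v
    using degree[OF ne(4) last1(1), of u v] that last1(2) by blast
  consider (cyc) "3 \<le> n" "(last xs, hd xs) \<in> E"
    | (both) u v where "\<not> (3 \<le> n \<and> (last xs, hd xs) \<in> E)" "u \<in> K" "v \<in> K" "(u, hd xs) \<in> E" "(last xs, v) \<in> E"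
    | (left) u where "\<not> (3 \<le> n \<and> (last xs, hd xs) \<in> E)" "u \<in> K" "(u, hd xs) \<in> E" "\<forall>v\<in>K. (last xs, v) \<notin> E"
    | (right) v where "\<not> (3 \<le> n \<and> (last xs, hd xs) \<in> E)" "v \<in> K" "(last xs, v) \<in> E" "\<forall>u\<in>K. (u, hd xs) \<notin> E"
    | (none) "\<not> (3 \<le> n \<and> (last xs, hd xs) \<in> E)" "\<forall>v\<in>K. (last xs, v) \<notin> E" "\<forall>u\<in>K. (u, hd xs) \<notin> E"
    by blast
  then show ?thesis
  proof cases
    case cyc
    \<comment> \<open>On a cycle both neighbors of each end lie on the path, so the conditions about
      \<open>K\<close> hold vacuously.\<close>
    have "last xs \<noteq> xs ! 1" "hd xs \<noteq> xs ! (n - 2)"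
      using cyc(1) assms(1) ne(1) unfolding path_def n_def
      by (auto simp: last_conv_nth hd_conv_nth nth_eq_iff_index_eq)
    then have "\<forall>u\<in>K. (u, hd xs) \<notin> E" "\<forall>v\<in>K. (last xs, v) \<notin> E"
      using degree[OF ne(3) hd1(1), of "last xs"] degree[OF ne(4) last1(1), of "hd xs"]
        cyc(2) hd1 last1 ne symE by metis+
    moreover have "6 \<le> n"
      using cycle[OF assms(1)] cyc unfolding n_def by blast
    ultimately show ?thesis
      using rainbow_cyclic by blast
  next
    case both
    \<comment> \<open>The case \<open>u = v\<close> is covered too, because the path has at least
      two vertices.\<close>
    have "5 \<le> n"
      using thread[OF assms(1) both(2-5)] assms(2) unfolding n_def by blast
    from rainbow_between[OF this f f] obtain g
      where "rainbow n g" "g 0 = 0" "g 1 = f u (hd xs)" "g n = f v (last xs)" "g (n + 1) = 0"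
      by blast
    with both left right show ?thesis by blast
  next
    case left': left
    obtain g where "rainbow n g" "g 0 = 0" "g 1 = f u (hd xs)"
      using rainbow_from[OF f] by blast
    with left' left show ?thesis by blast
  next
    case right': right
    obtain g where g: "rainbow n g" "g 0 = 0" "g 1 = f v (last xs)"
      using rainbow_from[OF f] by blast
    show ?thesis
      by (rule exI[of _ "\<lambda>i. g (n + 1 - i)"]) (use rainbow_rev[OF g(1)] g right' right in auto)
  next
    case none
    then show ?thesis
      using rainbow_from[of 1 n] by blast
  qed
qed

text \<open>The boundary word is read off along the path. Each path vertex and its neighbors fall
  into one window of the word, so distinct letters there give distinct colors.\<close>

lemma color_path:
  assumes path: "path xs" and closed: "\<And>x y. x \<in> set xs \<Longrightarrow> (x, y) \<in> E \<Longrightarrow> y \<in> set xs \<union> K"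
  shows "\<exists>c. (\<forall>x\<in>K. c x = 0) \<and> (\<forall>w\<in>set xs. good_at c w)"
proof (cases "2 \<le> length xs")
  case False
  then obtain w where "xs = [w]"
    using path unfolding path_def by (cases xs) (auto simp: not_le less_Suc_eq)
  then show ?thesis
    using color_singleton[of w] closed path unfolding path_def by auto
next
  case True
  define n where "n = length xs"
  have n: "2 \<le> n" "xs \<noteq> []" and dist: "distinct xs" and K: "set xs \<inter> K = {}"
    using True path unfolding path_def n_def by auto
  obtain g where g: "rainbow n g"
    and left: "\<And>u. u \<in> K \<Longrightarrow> (u, hd xs) \<in> E \<Longrightarrow> g 0 = 0 \<and> g 1 = f u (hd xs)"
    and right: "\<And>v. v \<in> K \<Longrightarrow> (last xs, v) \<in> E \<Longrightarrow> g (n + 1) = 0 \<and> g n = f v (last xs)"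
    and cyc: "3 \<le> n \<Longrightarrow> (last xs, hd xs) \<in> E \<Longrightarrow> g 0 = g n \<and> g (n + 1) = g 1"
    using boundary_word[OF path True] unfolding n_def by blast
  have hd: "hd xs = xs ! 0" and last: "last xs = xs ! (n - 1)"
    using n(2) by (auto simp: hd_conv_nth last_conv_nth n_def)
  define c where "c x = (if x \<in> set xs then g (inv_into {..<n} ((!) xs) x + 1) else 0)" for x
  have c_nth: "c (xs ! i) = g (i + 1)" if "i < n" for i
  proof -
    have "inj_on ((!) xs) {..<n}"
      using dist by (simp add: inj_on_def n_def nth_eq_iff_index_eq)
    then show ?thesis
      using that by (simp add: c_def inv_into_f_f n_def)
  qed
  have c_K: "c x = 0" if "x \<in> K" for x
    using K that by (auto simp: c_def)
  \<comment> \<open>The path vertices occupy the slots \<open>1, \<dots>, n\<close>; a further neighbor of either end, if there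
    is one, occupies the slot 0 or \<open>n + 1\<close>.\<close>
  define slot where "slot j y \<longleftrightarrow> (if j = 0 then (xs ! 0, y) \<in> E \<and> y \<noteq> xs ! 1
      else if j = n + 1 then (xs ! (n - 1), y) \<in> E \<and> y \<noteq> xs ! (n - 2)
      else j \<le> n \<and> y = xs ! (j - 1))" for j y
  have notK: "xs ! i \<notin> K" if "i < n" for i
    using path_nth_notin[OF path] that by (simp add: n_def)
  have step: "(xs ! i, xs ! (i + 1)) \<in> E" if "i + 1 < n" for i
    using path_nth_Suc[OF path] that by (simp add: n_def)
  have step0: "(xs ! 0, xs ! 1) \<in> E"
    using step[of 0] n(1) by simp
  have step1: "(xs ! (n - 1), xs ! (n - 2)) \<in> E"
    using symE[OF step[of "n - 2"]] n(1) by (simp add: Suc_diff_Suc numeral_2_eq_2)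
  have slot_unique: "y = z" if "slot j y" "slot j z" for j y z
    using that degree[OF notK[of 0] step0, of y z] degree[OF notK[of "n - 1"] step1, of y z] n(1)
    by (auto simp: slot_def split: if_splits)
  \<comment> \<open>If \<open>y\<close> were an inner vertex of the path, its only neighbors would
    be its list neighbors, so \<open>xs ! i\<close> would be one of them.\<close>
  have in_path: "y = xs ! 0 \<or> y = xs ! (n - 1)"
    if y: "y \<notin> K" "y \<noteq> xs ! (i - 1) \<or> i = 0" "y \<noteq> xs ! (i + 1) \<or> i + 1 = n" "(xs ! i, y) \<in> E" "i < n"
    for i y
  proof -
    have "y \<in> set xs"
      using closed[of "xs ! i" y] y by (auto simp: n_def)
    then obtain k where k: "k < n" "y = xs ! k"
      by (metis in_set_conv_nth n_def)
    show ?thesis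
    proof (rule ccontr)
      assume "\<not> ?thesis"
      then have "0 < k" "k + 1 < n"
        using k by (metis gr0I, metis Suc_eq_plus1 Suc_lessI add_diff_cancel_right' k(1) k(2))
      then have "xs ! i = xs ! (k - 1) \<or> xs ! i = xs ! (k + 1)"
        using inner_neighbor[OF path, of k "xs ! i"] symE y(4) k by (auto simp: n_def)
      then have "i = k - 1 \<or> i = k + 1"
        using dist \<open>k + 1 < n\<close> y(5) by (auto simp: n_def nth_eq_iff_index_eq)
      then have "k = i + 1 \<or> i = k + 1"
        using \<open>0 < k\<close> by linarith
      then show False
        using y k \<open>k + 1 < n\<close> by auto
    qed
  qed
  \<comment> \<open>An outer slot holds either a vertex of \<open>K\<close>, for which the word
    provides the letter 0, or the opposite end of a path closing up to a cycle, whose letter the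
    cyclic word repeats.\<close>
  have c_slot: "c y = g j" if s: "slot j y" for j y
  proof -
    consider "j = 0" | "j = n + 1" | "0 < j" "j \<le> n"
      using s by (auto simp: slot_def split: if_splits)
    then show ?thesis
    proof cases
      case 1
      then have y: "(xs ! 0, y) \<in> E" "y \<noteq> xs ! 1"
        using s by (auto simp: slot_def)
      show ?thesis
      proof (cases "y \<in> K")
        case True
        then show ?thesis using left[of y] y symE 1 by (simp add: hd c_K)
      next
        case False
        have "y \<noteq> xs ! 0" using y irrefl by auto
        then have y': "y = xs ! (n - 1)"
          using in_path[of y 0] y False n(1) by auto
        \<comment> \<open>For \<open>n = 2\<close> the opposite end is the list neighbor that slot 0
          excludes.\<close>
        have "n \<noteq> 2" using y y' by auto
        then show ?thesis
          using y y' symE cyc 1 c_nth[of "n - 1"] n(1) by (auto simp: hd last)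
      qed
    next
      case 2
      then have y: "(xs ! (n - 1), y) \<in> E" "y \<noteq> xs ! (n - 2)"
        using s by (auto simp: slot_def)
      show ?thesis
      proof (cases "y \<in> K")
        case True
        then show ?thesis using right[of y] y 2 by (simp add: last c_K)
      next
        case False
        have "y \<noteq> xs ! (n - 1)" using y irrefl by auto
        then have y': "y = xs ! 0"
          using in_path[of y "n - 1"] y False n(1) by (auto simp: numeral_2_eq_2)
        have "n \<noteq> 2" using y y' by auto
        then show ?thesis
          using y y' cyc 2 c_nth[of 0] n(1) by (auto simp: hd last)
      qed
    next
      case 3
      then show ?thesis
        using s c_nth[of "j - 1"] by (auto simp: slot_def)
    qed
  qed
  have nb_slot: "slot i y \<or> slot (i + 2) y" if "i < n" "(xs ! i, y) \<in> E" for i y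
  proof -
    have "i = 0 \<or> i = n - 1 \<and> 0 < i \<or> 0 < i \<and> i + 1 < n"
      using that(1) by linarith
    then consider "i = 0" | "i = n - 1" "0 < i" | "0 < i" "i + 1 < n"
      by blast
    then show ?thesis
    proof cases
      case 3
      then show ?thesis
        using inner_neighbor[OF path, of i y] that by (auto simp: slot_def n_def)
    qed (use that n(1) in \<open>auto simp: slot_def numeral_2_eq_2\<close>)
  qed
  have "good_at c (xs ! i)" if i: "i < n" for i
    unfolding good_at_def
  proof (intro conjI ballI impI)
    show "c (xs ! i) < 4"
      using g i by (simp add: c_nth rainbow_def)
    have slot': "\<exists>j\<in>{i, i + 1, i + 2}. slot j y" if "y \<in> insert (xs ! i) (E `` {xs ! i})" for y
      using nb_slot[OF i, of y] that i by (auto simp: slot_def)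
    have "inj_on g {i, i + 1, i + 2}"
      using g i by (auto simp: rainbow_def)
    \<comment> \<open>Equal colors mean equal letters within one window, hence the same slot, and a
      slot holds at most one vertex.\<close>
    then show "inj_on c (insert (xs ! i) (E `` {xs ! i}))"
      by (intro inj_onI) (metis c_slot inj_onD slot' slot_unique)
    show "c (xs ! i) = f u (xs ! i)" if u: "u \<in> K" "(xs ! i, u) \<in> E" for u
    proof -
      have "i = 0 \<or> i = n - 1 \<or> 0 < i \<and> i + 1 < n"
        using i by linarith
      then consider "i = 0" | "i = n - 1" | "0 < i" "i + 1 < n"
        by blast
      then show ?thesis
      proof cases
        case 1
        then show ?thesis using left[OF u(1)] u(2) symE c_nth[OF i] by (simp add: hd)
      next
        case 2
        then show ?thesis using right[OF u(1)] u(2) c_nth[OF i] n(1) by (simp add: last)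
      next
        case 3
        then have "u = xs ! (i - 1) \<or> u = xs ! (i + 1)"
          using inner_neighbor[OF path, of i u] u by (simp add: n_def)
        then show ?thesis using notK[of "i - 1"] notK[of "i + 1"] u(1) 3 less_imp_diff_less[OF i] by auto
      qed
    qed
  qed
  then have "\<forall>w\<in>set xs. good_at c w"
    by (metis in_set_conv_nth n_def)
  then show ?thesis
    using c_K by blast
qed

text \<open>A longest path in \<open>W\<close> contains all neighbors of its vertices outside
  \<open>K\<close>, so no edge joins it to the rest of \<open>W\<close>. The rest is colored by
  induction; the two colorings agree on \<open>K\<close> and can be merged.\<close>

lemma ex_coloring:
  assumes "finite W" "W \<inter> K = {}" "E `` W \<subseteq> W \<union> K"
  shows "\<exists>c. (\<forall>x\<in>K. c x = 0) \<and> (\<forall>w\<in>W. good_at c w)"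
  using assms
proof (induction W rule: finite_psubset_induct)
  case (psubset W)
  show ?case
  proof (cases "W = {}")
    case True
    then show ?thesis by (intro exI[of _ "\<lambda>_. 0"]) auto
  next
    case False
    then obtain w where "w \<in> W" by blast
    define P where "P xs \<longleftrightarrow> path xs \<and> set xs \<subseteq> W" for xs
    have "P [w]"
      using \<open>w \<in> W\<close> psubset.prems(1) unfolding P_def path_def by auto
    moreover have "\<forall>xs. P xs \<longrightarrow> length xs < card W + 1"
      unfolding P_def path_def by (metis card_mono distinct_card less_add_one
          order_le_less_trans psubset.hyps(1))
    ultimately obtain xs where "P xs" and max: "\<And>ys. P ys \<Longrightarrow> length ys \<le> length xs"
      using ex_has_greatest_nat[of P "[w]" length "card W + 1"] by blast
    then have xs: "path xs" "set xs \<subseteq> W" "xs \<noteq> []"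
      unfolding P_def path_def by auto
    have closed: "y \<in> set xs \<union> K" if "x \<in> set xs" "(x, y) \<in> E" for x y
    proof (cases "y \<in> K")
      case False
      then have "y \<in> W" using psubset.prems(2) that xs(2) by blast
      then show ?thesis
        using maximal_path_closed[OF xs(1) that] max xs(2) unfolding P_def by blast
    qed simp
    have "\<exists>c. (\<forall>x\<in>K. c x = 0) \<and> (\<forall>w\<in>set xs. good_at c w)"
      using xs(1) by (rule color_path) (rule closed)
    then obtain c1 where c1: "\<forall>x\<in>K. c1 x = 0" "\<forall>w\<in>set xs. good_at c1 w"
      by blast
    have no_edge: "(x, y) \<notin> E" if "x \<in> W - set xs" "y \<in> set xs" for x y
      using closed[OF that(2) symE] that(1) psubset.prems(1) by auto
    have "W - set xs \<subset> W"
      using xs(2,3) by (cases xs) auto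
    moreover have "E `` (W - set xs) \<subseteq> (W - set xs) \<union> K"
      using no_edge psubset.prems(2) by blast
    ultimately obtain c2 where c2: "\<forall>x\<in>K. c2 x = 0" "\<forall>w\<in>W - set xs. good_at c2 w"
      using psubset.IH[of "W - set xs"] psubset.prems(1) by blast
    define c where "c x = (if x \<in> set xs then c1 x else c2 x)" for x
    \<comment> \<open>\<open>good_at\<close> depends only on the colors in the closed neighborhood,
      which lies in one of the two pieces together with \<open>K\<close>.\<close>
    have cong: "good_at c w" if "good_at c' w" "\<And>x. x = w \<or> (w, x) \<in> E \<Longrightarrow> c x = c' x" for c' w
    proof -
      have "inj_on c (insert w (E `` {w})) = inj_on c' (insert w (E `` {w}))"
        by (rule inj_on_cong) (use that(2) in auto)
      then show ?thesis
        using that unfolding good_at_def by auto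
    qed
    have "good_at c w" if "w \<in> W" for w
    proof (cases "w \<in> set xs")
      case True
      then have "c x = c1 x" if "x = w \<or> (w, x) \<in> E" for x
        using closed[OF True, of x] that c1(1) c2(1) by (auto simp: c_def)
      then show ?thesis
        using cong[of c1] c1(2) True by blast
    next
      case False
      show ?thesis
        by (rule cong[of c2]) (use False that no_edge[of w] c2 in \<open>auto simp: c_def\<close>)
    qed
    moreover have "\<forall>x\<in>K. c x = 0"
      using c1 c2 by (auto simp: c_def)
    ultimately show ?thesis by blast
  qed
qed

end

section \<open>From vertex lists to walks, distance and girth\<close>

context pair_graph
begin

lemma vwalk_arcs_walk:
  assumes "successively (\<lambda>x y. (x, y) \<in> parcs G) (u # xs)" "u \<in> pverts G"
  shows "awalk u (vwalk_arcs (u # xs)) (last (u # xs))"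
    and "pawalk_verts u (vwalk_arcs (u # xs)) = u # xs"
    and "length (vwalk_arcs (u # xs)) = length xs"
  using assms
  by (induction xs arbitrary: u) (auto simp: awalk_Cons_iff awalk_Nil_iff dest: in_arcsD2)

lemma graph_dist_le_walk:
  assumes "successively (\<lambda>x y. (x, y) \<in> parcs G) (u # xs)" "u \<in> pverts G"
  shows "graph_dist G u (last (u # xs)) \<le> length xs"
proof -
  have "awalk_cost (\<lambda>_. 1) p = length p" for p :: "('a \<times> 'a) list"
    by (induction p) auto
  then show ?thesis
    using min_cost_le_walk_cost[OF vwalk_arcs_walk(1)[OF assms], of "\<lambda>_. 1"]
      vwalk_arcs_walk(3)[OF assms] by (simp add: graph_dist_def)
qed

text \<open>Prefixing the last vertex turns the list into a closed walk with as many arcs as the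
  list has vertices.\<close>

lemma girth_le_cycle:
  assumes "successively (\<lambda>x y. (x, y) \<in> parcs G) xs" "distinct xs" "3 \<le> length xs"
    "(last xs, hd xs) \<in> parcs G"
  shows "girth G \<le> length xs"
proof -
  let ?ys = "last xs # xs"
  have s: "successively (\<lambda>x y. (x, y) \<in> parcs G) ?ys" and v: "last xs \<in> pverts G"
    using assms by (auto simp: successively_Cons dest: in_arcsD1)
  note w = vwalk_arcs_walk[OF s v]
  have "cycle (vwalk_arcs ?ys)"
    unfolding cycle_def using w assms(2,3) by (intro exI[of _ "last xs"]) auto
  then show ?thesis
    unfolding girth_def using w(3) assms(3) by (intro INF_lower2[of "vwalk_arcs ?ys"]) auto
qed

lemma out_degree_ge_3:
  assumes "(w, x) \<in> parcs G" "(w, y) \<in> parcs G" "(w, z) \<in> parcs G" "x \<noteq> y" "y \<noteq> z" "x \<noteq> z"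
  shows "out_degree (with_proj G) w \<ge> 3"
proof -
  have "card {(w, x), (w, y), (w, z)} \<le> card (out_arcs (with_proj G) w)"
    using assms pair_finite_arcs by (intro card_mono) (auto simp: out_arcs_def)
  then show ?thesis
    using assms by (simp add: out_degree_def)
qed

end

section \<open>The coloring of the whole graph\<close>

theorem theorem2p1:
  fixes G :: "'a pair_pre_digraph"
  assumes "pair_graph G"
    and "girth G \<ge> 6"
    and "\<And>u v. u \<in> K G \<Longrightarrow> v \<in> K G \<Longrightarrow> u \<noteq> v \<Longrightarrow> graph_dist G u v \<ge> 6"
  shows "pcf_chromatic_number G \<le> 4"
proof -
  interpret pair_graph G by fact
  let ?E = "parcs G" and ?V = "pverts G"
  \<comment> \<open>The neighbor \<open>s u\<close> is to carry the color that is unique around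
    \<open>u\<close>. Vertices of \<open>K\<close> have neighbors, so the choice is meaningful
    there.\<close>
  define s where "s u = (SOME w. (u, w) \<in> ?E)" for u
  define f :: "'a \<Rightarrow> 'a \<Rightarrow> nat" where "f u w = (if w = s u then 1 else 2)" for u w
  have KV: "K G \<subseteq> ?V"
    by (auto simp: K_def)
  \<comment> \<open>With inner vertices \<open>xs\<close> the walk has \<open>length xs + 1\<close>
    edges, so distance at least 6 leaves at least five inner vertices.\<close>
  have short: "5 \<le> length xs"
    if "successively (\<lambda>x y. (x, y) \<in> ?E) (u # xs @ [v])" "u \<in> K G" "v \<in> K G" "u \<noteq> v" for u v xs
  proof -
    have "6 \<le> graph_dist G u v"
      using assms(3) that by blast
    also have "\<dots> \<le> length (xs @ [v])"
      using graph_dist_le_walk[OF that(1)] KV that(2) by auto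
    finally show ?thesis by simp
  qed
  have long: "6 \<le> length xs"
    if "successively (\<lambda>x y. (x, y) \<in> ?E) xs" "distinct xs" "3 \<le> length xs" "(last xs, hd xs) \<in> ?E" for xs
  proof -
    have "(6 :: enat) \<le> length xs"
      using girth_le_cycle[OF that] assms(2) order_trans by blast
    then show ?thesis by (simp add: numeral_eq_enat)
  qed
  interpret far_branching ?E "K G" f
    "\<lambda>xs. xs \<noteq> [] \<and> distinct xs \<and> set xs \<inter> K G = {} \<and> successively (\<lambda>x y. (x, y) \<in> ?E) xs"
  proof unfold_locales
    show "(y, x) \<in> ?E" if "(x, y) \<in> ?E" for x y
      using arcs_symmetric[OF that] .
    show "(x, x) \<notin> ?E" for x
      using no_loops' by blast
    show "x = y \<or> y = z \<or> x = z" if "w \<notin> K G" "(w, x) \<in> ?E" "(w, y) \<in> ?E" "(w, z) \<in> ?E" for w x y z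
      using out_degree_ge_3[OF that(2-4)] that(1) in_arcsD1[OF that(2)] by (auto simp: K_def)
    show "f u w \<in> {1, 2}" for u w
      by (simp add: f_def)
    fix xs
    assume path: "xs \<noteq> [] \<and> distinct xs \<and> set xs \<inter> K G = {} \<and> successively (\<lambda>x y. (x, y) \<in> ?E) xs"
    show "6 \<le> length xs" if "3 \<le> length xs" "(last xs, hd xs) \<in> ?E"
      using long path that by blast
    show "5 \<le> length xs" if "u \<in> K G" "v \<in> K G" "(u, hd xs) \<in> ?E" "(last xs, v) \<in> ?E"
      "u \<noteq> v \<or> 2 \<le> length xs" for u v
    proof (cases "u = v")
      \<comment> \<open>Here \<open>u # xs\<close> is a cycle with \<open>length xs + 1\<close>
        vertices, at least three, so the girth applies.\<close>
      case True
      then show ?thesis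
        using long[of "u # xs"] path that by (auto simp: successively_Cons)
    next
      case False
      then show ?thesis
        using short[of u xs v] path that by (auto simp: successively_Cons successively_append_iff)
    qed
  qed auto
  have "finite (?V - K G)" "(?V - K G) \<inter> K G = {}" "?E `` (?V - K G) \<subseteq> (?V - K G) \<union> K G"
    using pair_finite_verts in_arcsD2 by auto
  then have "\<exists>c. (\<forall>x\<in>K G. c x = 0) \<and> (\<forall>w\<in>?V - K G. good_at c w)"
    by (rule ex_coloring)
  then obtain c where "\<forall>x\<in>K G. c x = 0" "\<forall>w\<in>?V - K G. good_at c w"
    by (elim exE conjE)
  then have c0: "\<And>x. x \<in> K G \<Longrightarrow> c x = 0" and c: "\<And>w. w \<in> ?V - K G \<Longrightarrow> good_at c w"
    by blast+
  have cK: "v \<in> ?V - K G \<and> c v = f u v" if "u \<in> K G" "(u, v) \<in> ?E" for u v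
  proof -
    \<comment> \<open>A walk without inner vertices between vertices of \<open>K\<close> contradicts
      \<open>short\<close>, so \<open>K\<close> is independent.\<close>
    have "v \<notin> K G"
      using short[of u "[]" v] that no_loops' by auto
    then have "v \<in> ?V - K G" using in_arcsD2 that(2) by blast
    then show ?thesis
      using c[of v] that arcs_symmetric unfolding good_at_def by auto
  qed
  have "proper_coloring G c"
    unfolding proper_coloring_def
  proof (intro allI impI)
    fix u v assume e: "(u, v) \<in> ?E"
    show "c u \<noteq> c v"
    proof (cases "u \<in> K G")
      case True
      then show ?thesis using cK[OF True e] c0 by (simp add: f_def)
    next
      case False
      then have "inj_on c (insert u (?E `` {u}))"
        using c in_arcsD1[OF e] unfolding good_at_def by blast
      then show ?thesis
        using e no_loops'[OF e] by (auto dest: inj_onD)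
    qed
  qed
  moreover have "conflict_free G c"
    unfolding conflict_free_def
  proof (intro ballI impI)
    fix x assume x: "x \<in> ?V" and "neighborhood G x \<noteq> {}"
    then obtain y where y: "(x, y) \<in> ?E" by (auto simp: neighborhood_def)
    \<comment> \<open>For \<open>x\<close> in \<open>K\<close> the witness is \<open>s x\<close>,
      the only neighbor colored 1; otherwise any neighbor serves.\<close>
    have "\<exists>z. {y \<in> neighborhood G x. c y = c z} = {z}"
    proof (cases "x \<in> K G")
      case True
      have "(x, s x) \<in> ?E"
        unfolding s_def using y by (rule someI)
      then have "{y \<in> neighborhood G x. c y = c (s x)} = {s x}"
        using cK[OF True] by (auto simp: neighborhood_def f_def split: if_splits)
      then show ?thesis ..
    next
      case False
      then have "inj_on c (insert x (?E `` {x}))"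
        using c x unfolding good_at_def by blast
      then have "{z \<in> neighborhood G x. c z = c y} = {y}"
        using y by (auto simp: neighborhood_def dest: inj_onD)
      then show ?thesis ..
    qed
    then obtain z where "{y \<in> neighborhood G x. c y = c z} = {z}" ..
    then have "card {y \<in> neighborhood G x. c y = c z} = 1" by simp
    then show "\<exists>a. card {y \<in> neighborhood G x. c y = a} = 1" ..
  qed
  moreover have "card (c ` ?V) \<le> 4"
  proof -
    have "c ` ?V \<subseteq> {..<4}"
      using c c0 unfolding good_at_def by force
    then show ?thesis
      using card_mono[of "{..<4::nat}" "c ` ?V"] by simp
  qed
  ultimately have "pcf_coloring G 4 c"
    by (simp add: pcf_coloring_def)
  then show ?thesis
    unfolding pcf_chromatic_number_def by (intro Least_le) blast
qed

end
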